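(* Let $n\ge 1$ be an integer and write $2n-1$ in base $10$ as $2n-1=\sum_{k=0}^{m}a_k\cdot 10^k$, where $m+1$ is the number of decimal digits of $2n-1$, so that $a_0\in\{1,3,5,7,9\}$ (i.e. $a_0\equiv 1 \pmod 2$), $0\le a_k\le 9$ for all $k$, and $a_m\neq 0$. Then \[ b(n)=C(1\rightarrow 2n-1)=C\Bigl(1\rightarrow\sum_{k=0}^{m}a_k\cdot 10^k\Bigr) \] and \[ b(n)=\frac{25}{44}\Bigl[45^{m}-1\Bigr]+\sum_{k=1}^{m}\Bigl[\prod_{k<j\le m}a_j\Bigr]\Bigl[5^{k+1}\cdot 9^{k-1}\cdot\frac{a_k\,(a_k-1)}{2}\Bigr]+\Bigl[\prod_{i=1}^{m}a_i\Bigr]\Bigl(\frac{a_0+1}{2}\Bigr)^{2}. \]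
   Context: For a positive integer $p$, $C(p)$ denotes the product of the decimal digits of $p$ (no leading zeros). For $n\ge 1$, $b(n)=\sum_{i=1}^{n}C(2i-1)$ is the sum of the products of the digits of the first $n$ odd numbers $1,3,\dots,2n-1$ (with $b(0)=0$). For positive odd integers $d\le e$, $C(d\rightarrow e)=b(\lceil e/2\rceil)-b(\lceil d/2\rceil-1)$ is the sum of $C(p)$ over all odd integers $p$ with $d\le p\le e$. Empty products are equal to $1$ and empty sums are equal to $0$. *)

theory Defs
  imports Complex_Main "HOL-Library.Log_Nat"
begin

(* For p > 0, floorlog 10 p is the number of decimal digits of p (without leading zeros),
   and (p div 10 ^ i) mod 10 is the digit at 10 ^ i.  At p = 0 the product is empty. *)
definition digit_prod :: "nat \<Rightarrow> nat" where
  "digit_prod p = (\<Prod>i<floorlog 10 p. (p div 10 ^ i) mod 10)"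

definition odd_digit_prod_sum :: "nat \<Rightarrow> nat" where
  "odd_digit_prod_sum n = (\<Sum>i = 1..n. digit_prod (2 * i - 1))"

(* The sum C(d -> e), meaningful for odd d <= e; it is integer-valued so that the
   difference is a genuine subtraction. *)
definition odd_digit_prod_range :: "nat \<Rightarrow> nat \<Rightarrow> int" where
  "odd_digit_prod_range d e =
     int (odd_digit_prod_sum (nat \<lceil>real e / 2\<rceil>))
     - int (odd_digit_prod_sum (nat (\<lceil>real d / 2\<rceil> - 1)))"

lemma ceiling_odd_half: "\<lceil>real (2 * k + 1) / 2\<rceil> = int k + 1"
  by (rule ceiling_unique) auto

lemma odd_digit_prod_range_eq_sum:
  assumes "odd d" "odd e" "d \<le> e"
  shows "odd_digit_prod_range d e = int (\<Sum>p | odd p \<and> d \<le> p \<and> p \<le> e. digit_prod p)"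
proof -
  obtain s t where s: "d = 2 * s + 1" and t: "e = 2 * t + 1"
    using assms by (auto elim!: oddE)
  have st: "s \<le> t" using assms(3) s t by simp
  let ?f = "\<lambda>i. digit_prod (2 * i - 1)"
  have split: "{1..t + 1} = {1..s} \<union> {s + 1..t + 1}" using st by auto
  have "sum ?f {1..t + 1} = sum ?f {1..s} + sum ?f {s + 1..t + 1}"
    unfolding split by (rule sum.union_disjoint) auto
  moreover have "sum ?f {s + 1..t + 1} = (\<Sum>p | odd p \<and> d \<le> p \<and> p \<le> e. digit_prod p)"
    by (rule sum.reindex_bij_witness[where i = "\<lambda>p. (p + 1) div 2" and j = "\<lambda>i. 2 * i - 1"])
       (auto simp: s t elim!: oddE)
  ultimately show ?thesis
    unfolding odd_digit_prod_range_def s t ceiling_odd_half odd_digit_prod_sum_def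
    by (simp add: nat_add_distrib)
qed

end

theory Submission
  imports Defs
begin

text \<open>
  The idea is to strip the lowest digit. For a positive number, the product of the digits of
  \<open>10 * q + r\<close> is the product of the digits of \<open>q\<close> times \<open>r\<close>, where the empty product for
  \<open>q = 0\<close> takes care of one-digit numbers. Write \<open>2 * n - 1 = 10 * M + a 0\<close> and group the odd
  numbers up to it by their quotient \<open>q\<close> by \<open>10\<close>. Every \<open>q < M\<close> occurs with the five last digits
  \<open>1, 3, 5, 7, 9\<close>, whose sum is \<open>25\<close>, and \<open>q = M\<close> occurs with the odd digits up to \<open>a 0\<close>, whose
  sum is a square (\<open>odd_digit_prod_sum_block\<close>). It remains to sum the digit products of \<^emph>\<open>all\<close>
  numbers below \<open>M\<close>.

  The same grouping, now with last digits \<open>0, ..., 9\<close> of sum \<open>45\<close>, expresses the sum below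
  \<open>10 * M + c\<close> through the sum below \<open>M\<close> and the digit product of \<open>M\<close>
  (\<open>sum_digit_prod_below_block\<close>). The number \<open>0\<close> is exceptional: it contributes the empty product
  \<open>1\<close> although its last digit is \<open>0\<close>. This extra \<open>1\<close>, carried through the recursion, produces
  the geometric sum \<open>1 + 45 + 45^2 + ... = (45^m - 1) / 44\<close>, while the contributions of the
  incomplete blocks produce the sum over the digit positions (\<open>sum_digit_prod_below\<close>).
\<close>

section \<open>The digit product and the last digit\<close>

text \<open>The last summand corrects the case \<open>p = 0\<close>, where the product is empty but the remainder
  vanishes. Having it as a summand makes the equation unconditional, so it can be summed.\<close>
lemma digit_prod_rec:
  "digit_prod p = digit_prod (p div 10) * (p mod 10) + of_bool (p = 0)"
proof (cases "p = 0")
  case True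
  then show ?thesis by (simp add: digit_prod_def floorlog_def)
next
  case False
  then have "floorlog 10 p = Suc (floorlog 10 (p div 10))"
    by (subst compute_floorlog) simp
  then show ?thesis
    using False
    by (simp add: digit_prod_def prod.lessThan_Suc_shift div_mult2_eq del: prod.lessThan_Suc)
qed

lemma digit_prod_0 [simp]: "digit_prod 0 = 1"
  by (simp add: digit_prod_def floorlog_def)

lemma digit_prod_append_digit:
  assumes "r < 10" "10 * q + r > 0"
  shows "digit_prod (10 * q + r) = digit_prod q * r"
  using assms by (subst digit_prod_rec) auto

lemma decimal_sum_Suc:
  fixes c :: "nat \<Rightarrow> nat"
  shows "(\<Sum>k<Suc m. c k * 10 ^ k) = 10 * (\<Sum>k<m. c (Suc k) * 10 ^ k) + c 0"
  by (simp add: sum.lessThan_Suc_shift sum_distrib_left mult_ac del: sum.lessThan_Suc)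

lemma digit_prod_decimal_sum:
  assumes "\<And>k. k < m \<Longrightarrow> c k \<le> 9" "m > 0 \<Longrightarrow> c (m - 1) > 0"
  shows "digit_prod (\<Sum>k<m. c k * 10 ^ k) = (\<Prod>k<m. c k)"
  using assms
proof (induction m arbitrary: c)
  case 0
  then show ?case by simp
next
  case (Suc m)
  have pos: "(\<Sum>k<Suc m. c k * 10 ^ k) > 0"
    using Suc.prems(2) by simp
  have "digit_prod (\<Sum>k<m. c (Suc k) * 10 ^ k) = (\<Prod>k<m. c (Suc k))"
    by (rule Suc.IH) (use Suc.prems in \<open>auto simp: gr0_conv_Suc\<close>)
  moreover have "c 0 < 10"
    using Suc.prems(1)[of 0] by simp
  ultimately show ?case
    using pos
    by (simp add: decimal_sum_Suc digit_prod_append_digit prod.lessThan_Suc_shift mult.commute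
        del: sum.lessThan_Suc prod.lessThan_Suc)
qed

section \<open>Sums over blocks with a common quotient\<close>

lemma sum_lessThan_blocks:
  fixes f :: "nat \<Rightarrow> 'a::comm_monoid_add"
  shows "(\<Sum>i<k * M + c. f i) = (\<Sum>q<M. \<Sum>r<k. f (k * q + r)) + (\<Sum>r<c. f (k * M + r))"
proof -
  have add: "(\<Sum>i<N + c. f i) = (\<Sum>i<N. f i) + (\<Sum>r<c. f (N + r))" for N c
    by (induction c) (simp_all add: add.assoc)
  have "(\<Sum>i<k * M. f i) = (\<Sum>q<M. \<Sum>r<k. f (k * q + r))"
    by (induction M) (simp_all add: add add.commute[of k])
  then show ?thesis
    by (simp add: add)
qed

text \<open>The factor \<open>45\<close> is the sum of all digits, and the final \<open>1\<close> is the contribution of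
  \<open>p = 0\<close>.\<close>
lemma sum_digit_prod_below_block:
  assumes "c < 10" "10 * M + c > 0"
  shows "(\<Sum>p<10 * M + c. real (digit_prod p)) =
    45 * (\<Sum>q<M. real (digit_prod q)) + real (digit_prod M) * (real c * (real c - 1) / 2) + 1"
proof -
  let ?g = "\<lambda>p. real (digit_prod (p div 10)) * real (p mod 10)"
  have digits: "(\<Sum>r<c. real r) = real c * (real c - 1) / 2" for c
    by (induction c) (simp_all add: field_simps)
  have full: "(\<Sum>r<10. ?g (10 * q + r)) = 45 * real (digit_prod q)" for q
  proof -
    have "(\<Sum>r<10. ?g (10 * q + r)) = (\<Sum>r<10. real (digit_prod q) * real r)"
      by (rule sum.cong) auto
    also have "\<dots> = 45 * real (digit_prod q)"
      by (simp add: digits flip: sum_distrib_left)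
    finally show ?thesis .
  qed
  have "(\<Sum>r<c. ?g (10 * M + r)) = (\<Sum>r<c. real (digit_prod M) * real r)"
    using assms(1) by (intro sum.cong) auto
  then have last: "(\<Sum>r<c. ?g (10 * M + r)) = real (digit_prod M) * (real c * (real c - 1) / 2)"
    by (simp add: digits flip: sum_distrib_left)
  have zero: "(\<Sum>p<10 * M + c. of_bool (p = 0) :: real) = 1"
    using assms(2) by (simp add: of_bool_def)
  have "(\<Sum>p<10 * M + c. real (digit_prod p)) =
      (\<Sum>p<10 * M + c. ?g p + of_bool (p = 0))"
    by (intro sum.cong refl, subst digit_prod_rec) simp
  also have "\<dots> = (\<Sum>p<10 * M + c. ?g p) + 1"
    by (simp only: sum.distrib zero)
  also have "(\<Sum>p<10 * M + c. ?g p) =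
      45 * (\<Sum>q<M. real (digit_prod q)) + real (digit_prod M) * (real c * (real c - 1) / 2)"
    by (simp only: sum_lessThan_blocks full last flip: sum_distrib_left)
  finally show ?thesis .
qed

lemma odd_digit_prod_sum_block:
  assumes "c \<le> 5"
  shows "odd_digit_prod_sum (5 * M + c) = 25 * (\<Sum>q<M. digit_prod q) + digit_prod M * c\<^sup>2"
proof -
  have odds: "(\<Sum>r<c. 2 * r + 1) = c\<^sup>2" for c :: nat
    by (induction c) (simp_all add: power2_eq_square)
  have block: "(\<Sum>r<c. digit_prod (2 * (5 * q + r) + 1)) = digit_prod q * c\<^sup>2" if "c \<le> 5" for q c
  proof -
    have "digit_prod (2 * (5 * q + r) + 1) = digit_prod q * (2 * r + 1)" if "r < c" for r
      using digit_prod_append_digit[of "2 * r + 1" q] that \<open>c \<le> 5\<close> by (simp add: algebra_simps)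
    then show ?thesis
      by (simp flip: odds add: sum_distrib_left)
  qed
  have "odd_digit_prod_sum (5 * M + c) = (\<Sum>i<5 * M + c. digit_prod (2 * i + 1))"
    unfolding odd_digit_prod_sum_def
    by (rule sum.reindex_bij_witness[where i = Suc and j = "\<lambda>i. i - 1"])
       (auto simp: diff_mult_distrib2 Suc_diff_Suc numeral_2_eq_2)
  also have "\<dots> = (\<Sum>q<M. digit_prod q * 5\<^sup>2) + digit_prod M * c\<^sup>2"
    using assms by (simp only: sum_lessThan_blocks block order_refl)
  finally show ?thesis
    by (simp flip: sum_distrib_right)
qed

section \<open>Closed forms in terms of the digits\<close>

text \<open>The induction is on the number of digits and passes to the digits \<open>c 1, c 2, ...\<close> of the
  quotient by \<open>10\<close>, as \<open>sum_digit_prod_below_block\<close> demands. The condition on the leading digit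
  keeps the upper limit positive at every step, so that each step adds its \<open>1\<close>, and makes the
  digit product of each quotient the product of the remaining \<open>c k\<close>.\<close>
lemma sum_digit_prod_below:
  assumes "\<And>k. k < m \<Longrightarrow> c k \<le> 9" "m > 0 \<Longrightarrow> c (m - 1) > 0"
  shows "(\<Sum>p<(\<Sum>k<m. c k * 10 ^ k). real (digit_prod p)) =
    (45 ^ m - 1) / 44 +
    (\<Sum>k<m. (\<Prod>j\<in>{k<..<m}. real (c j)) * (45 ^ k * (real (c k) * (real (c k) - 1) / 2)))"
  using assms
proof (induction m arbitrary: c)
  case 0
  then show ?case by simp
next
  case (Suc m)
  define M where "M = (\<Sum>k<m. c (Suc k) * 10 ^ k)"
  let ?t = "\<lambda>k. real (c k) * (real (c k) - 1) / 2"
  have decomp: "(\<Sum>k<Suc m. c k * 10 ^ k) = 10 * M + c 0"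
    unfolding M_def by (rule decimal_sum_Suc)
  have pos: "10 * M + c 0 > 0"
    unfolding decomp[symmetric] using Suc.prems(2) by simp
  have shift: "(\<Prod>j\<in>{Suc k<..<Suc m}. real (c j)) = (\<Prod>j\<in>{k<..<m}. real (c (Suc j)))" for k
    by (rule prod.reindex_bij_witness[where i = Suc and j = "\<lambda>i. i - 1"]) auto
  have "digit_prod M = (\<Prod>k<m. c (Suc k))"
    unfolding M_def
    by (rule digit_prod_decimal_sum) (use Suc.prems in \<open>auto simp: gr0_conv_Suc\<close>)
  moreover have "(\<Prod>j\<in>{0<..<Suc m}. real (c j)) = (\<Prod>k<m. real (c (Suc k)))"
    by (rule prod.reindex_bij_witness[where i = Suc and j = "\<lambda>i. i - 1"]) auto
  ultimately have prod_M: "real (digit_prod M) = (\<Prod>j\<in>{0<..<Suc m}. real (c j))"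
    by simp
  have IH: "(\<Sum>q<M. real (digit_prod q)) = (45 ^ m - 1) / 44 +
      (\<Sum>k<m. (\<Prod>j\<in>{k<..<m}. real (c (Suc j))) * (45 ^ k * ?t (Suc k)))"
    unfolding M_def by (rule Suc.IH) (use Suc.prems in \<open>auto simp: gr0_conv_Suc\<close>)
  have "(\<Sum>p<10 * M + c 0. real (digit_prod p)) =
      45 * (\<Sum>q<M. real (digit_prod q)) + real (digit_prod M) * ?t 0 + 1"
    by (rule sum_digit_prod_below_block) (use Suc.prems(1)[of 0] pos in auto)
  also have "\<dots> = (45 ^ Suc m - 1) / 44 +
      (\<Sum>k<Suc m. (\<Prod>j\<in>{k<..<Suc m}. real (c j)) * (45 ^ k * ?t k))"
    unfolding IH prod_M sum.lessThan_Suc_shift shift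
    by (simp add: distrib_left sum_distrib_left mult_ac diff_divide_distrib)
  finally show ?case
    unfolding decomp .
qed

lemma odd_digit_prod_range_from_1:
  assumes "n \<ge> 1"
  shows "odd_digit_prod_range 1 (2 * n - 1) = int (odd_digit_prod_sum n)"
proof -
  have n: "2 * n - 1 = 2 * (n - 1) + 1"
    using assms by simp
  have "nat \<lceil>real (2 * n - 1) / 2\<rceil> = n"
    unfolding n ceiling_odd_half using assms by simp
  moreover have "\<lceil>real 1 / 2\<rceil> = 1"
    using ceiling_odd_half[of 0] by simp
  ultimately show ?thesis
    by (simp add: odd_digit_prod_range_def odd_digit_prod_sum_def)
qed

theorem theorem4:
  fixes n m :: nat and a :: "nat \<Rightarrow> nat"
  assumes "n \<ge> 1"
    and "m + 1 = floorlog 10 (2 * n - 1)"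
    and "2 * n - 1 = (\<Sum>k = 0..m. a k * 10 ^ k)"
    and "a 0 \<in> {1, 3, 5, 7, 9}"
    and "\<forall>k \<in> {0..m}. 0 \<le> a k \<and> a k \<le> 9"
    and "a m \<noteq> 0"
  shows "int (odd_digit_prod_sum n) = odd_digit_prod_range 1 (2 * n - 1)
    \<and> odd_digit_prod_range 1 (2 * n - 1) = odd_digit_prod_range 1 (\<Sum>k = 0..m. a k * 10 ^ k)
    \<and> real (odd_digit_prod_sum n) =
        25 / 44 * (45 ^ m - 1)
        + (\<Sum>k = 1..m. (\<Prod>j \<in> {k<..m}. real (a j))
            * (5 ^ (k + 1) * 9 ^ (k - 1) * (real (a k) * (real (a k) - 1) / 2)))
        + (\<Prod>i = 1..m. real (a i)) * ((real (a 0) + 1) / 2) ^ 2"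
proof (intro conjI)
  show "int (odd_digit_prod_sum n) = odd_digit_prod_range 1 (2 * n - 1)"
    using odd_digit_prod_range_from_1[OF assms(1)] by simp
  show "odd_digit_prod_range 1 (2 * n - 1) = odd_digit_prod_range 1 (\<Sum>k = 0..m. a k * 10 ^ k)"
    by (simp only: assms(3))
  define M where "M = (\<Sum>k<m. a (Suc k) * 10 ^ k)"
  define s where "s = (a 0 + 1) div 2"
  let ?t = "\<lambda>k. real (a k) * (real (a k) - 1) / 2"
  have a0: "a 0 + 1 = 2 * s" "s \<le> 5"
    using assms(4) unfolding s_def by auto
  have "2 * n - 1 = 10 * M + a 0"
    unfolding assms(3) M_def using decimal_sum_Suc[of a m]
    by (simp add: lessThan_Suc_atMost atLeast0AtMost)
  with a0(1) have n: "n = 5 * M + s"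
    using assms(1) by linarith
  have digits: "a (Suc k) \<le> 9" if "k < m" for k
    using assms(5) that by auto
  have lead: "a (Suc (m - 1)) > 0" if "m > 0"
    using assms(6) that by simp
  have "digit_prod M = (\<Prod>k<m. a (Suc k))"
    unfolding M_def by (rule digit_prod_decimal_sum) (use digits lead in auto)
  also have "\<dots> = (\<Prod>i = 1..m. a i)"
    by (rule prod.reindex_bij_witness[where i = "\<lambda>i. i - 1" and j = Suc]) auto
  finally have prod_M: "real (digit_prod M) = (\<Prod>i = 1..m. real (a i))"
    by simp
  have shift: "(\<Prod>j\<in>{k<..<m}. real (a (Suc j))) = (\<Prod>j\<in>{Suc k<..m}. real (a j))" for k
    by (rule prod.reindex_bij_witness[where i = "\<lambda>i. i - 1" and j = Suc]) auto
  have "(\<Sum>q<M. real (digit_prod q)) = (45 ^ m - 1) / 44 +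
      (\<Sum>k<m. (\<Prod>j\<in>{Suc k<..m}. real (a j)) * (45 ^ k * ?t (Suc k)))"
    unfolding M_def shift[symmetric]
    by (rule sum_digit_prod_below) (use digits lead in auto)
  then have "25 * (\<Sum>q<M. real (digit_prod q)) = 25 / 44 * (45 ^ m - 1) +
      (\<Sum>k<m. (\<Prod>j\<in>{Suc k<..m}. real (a j)) * (25 * 45 ^ k * ?t (Suc k)))"
    by (simp add: distrib_left sum_distrib_left mult_ac)
  also have "(\<Sum>k<m. (\<Prod>j\<in>{Suc k<..m}. real (a j)) * (25 * 45 ^ k * ?t (Suc k))) =
      (\<Sum>k = 1..m. (\<Prod>j\<in>{k<..m}. real (a j)) * (5 ^ (k + 1) * 9 ^ (k - 1) * ?t k))"
  proof (rule sum.reindex_bij_witness[where i = "\<lambda>i. i - 1" and j = Suc])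
    fix k
    have "(45 :: real) ^ k = 5 ^ k * 9 ^ k"
      by (simp flip: power_mult_distrib)
    then have "25 * 45 ^ k = (5 :: real) ^ (Suc k + 1) * 9 ^ (Suc k - 1)"
      by simp
    then show "(\<Prod>j\<in>{Suc k<..m}. real (a j)) * (5 ^ (Suc k + 1) * 9 ^ (Suc k - 1) * ?t (Suc k)) =
        (\<Prod>j\<in>{Suc k<..m}. real (a j)) * (25 * 45 ^ k * ?t (Suc k))"
      by simp
  qed auto
  finally have below: "25 * (\<Sum>q<M. real (digit_prod q)) = 25 / 44 * (45 ^ m - 1) +
      (\<Sum>k = 1..m. (\<Prod>j\<in>{k<..m}. real (a j)) * (5 ^ (k + 1) * 9 ^ (k - 1) * ?t k))" .
  have s: "real s = (real (a 0) + 1) / 2"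
    using arg_cong[OF a0(1), of real] by simp
  have "real (odd_digit_prod_sum n) =
      25 * (\<Sum>q<M. real (digit_prod q)) + real (digit_prod M) * (real s)\<^sup>2"
    unfolding n odd_digit_prod_sum_block[OF a0(2)] by simp
  then show "real (odd_digit_prod_sum n) =
        25 / 44 * (45 ^ m - 1)
        + (\<Sum>k = 1..m. (\<Prod>j \<in> {k<..m}. real (a j))
            * (5 ^ (k + 1) * 9 ^ (k - 1) * (real (a k) * (real (a k) - 1) / 2)))
        + (\<Prod>i = 1..m. real (a i)) * ((real (a 0) + 1) / 2) ^ 2"
    unfolding below prod_M s .
qed

end
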